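(* Let $(T,\eta,\mu)$ be a monad on a category $\mathcal{C}$ with Eilenberg-Moore adjunction $\mathcal{F}\dashv U$. Let $A$ be an endofunctor on $\mathcal{C}$ with initial algebra $\beta\colon A(\Psi)\xrightarrow{\cong}\Psi$, $\lambda\colon AT\Rightarrow TA$ a Kleisli law such that $(\Psi,J(\beta^{-1}))$ is a final coalgebra of the extension $\overline{A}$ of $A$ to $\mathcal{K}\ell(T)$, $B$ an endofunctor on $\mathcal{C}$ with final coalgebra $\zeta\colon\Theta\xrightarrow{\cong}B(\Theta)$, $\kappa\colon TB\Rightarrow BT$ an Eilenberg-Moore law with lifting $\overline{B}$, and $\rho\colon AU\Rightarrow U\overline{B}$ a natural transformation. Assume that for every Eilenberg-Moore algebra $(Y,b)$, $\rho_{(Y,b)}\circ A(b)=B(b)\circ\kappa_Y\circ T(\rho_{(Y,b)})\circ\lambda_Y$. Let $a\colon T(\Theta)\to\Theta$ be the unique map with $\zeta\circ a=B(a)\circ\kappa_\Theta\circ T(\zeta)$, let $\mathsf{k}\colon\Psi\to\Theta$ be the unique map with $\mathsf{k}\circ\beta=\zeta^{-1}\circ\rho_{(\Theta,a)}\circ A(\mathsf{k})$, and $\overline{\mathsf{k}}=a\circ T(\mathsf{k})\colon T(\Psi)\to\Theta$. Let $\ell_{\mathrm{kl}}=T(\beta)\circ\mu_{A(\Psi)}\circ T(\lambda_\Psi)$ and $\ell^A_{\mathrm{em}}=\zeta^{-1}\circ B(a)\circ(\rho_2)_\Theta\colon TA(\Theta)\to\Theta$. Then $\overline{\mathsf{k}}\circ\ell_{\mathrm{kl}}=\ell^A_{\mathrm{em}}\circ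 TA(\overline{\mathsf{k}})$. Consequently, for every coalgebra $c\colon X\to TA(X)$, $\overline{\mathsf{k}}\circ\mathsf{kl}_c=\mathsf{em}^A_c$, where $\mathsf{kl}_c\colon X\to T(\Psi)$ is the unique map with $\mathsf{kl}_c=\ell_{\mathrm{kl}}\circ TA(\mathsf{kl}_c)\circ c$ and $\mathsf{em}^A_c\colon X\to\Theta$ is the unique map with $\mathsf{em}^A_c=\ell^A_{\mathrm{em}}\circ TA(\mathsf{em}^A_c)\circ c$.
   Context: A Kleisli law satisfies $\lambda\circ A\eta=\eta A$, $\lambda\circ A\mu=\mu A\circ T\lambda\circ\lambda T$; its extension $\overline{A}$ sends a Kleisli map $f\colon X\to T(Y)$ to $\lambda_Y\circ A(f)$, and $J(f)=\eta\circ f$. An Eilenberg-Moore law satisfies $\kappa\circ\eta B=B\eta$, $\kappa\circ\mu B=B\mu\circ\kappa T\circ T\kappa$; its lifting is $\overline{B}(Y,b)=(B(Y),B(b)\circ\kappa_Y)$; $(\Theta,a)$ is an Eilenberg-Moore algebra. $(\rho_2)_X=B(\mu_X)\circ\kappa_{T(X)}\circ T(\rho_{(T(X),\mu_X)})\circ TA(\eta_X)$. The maps $\mathsf{k}$, $\mathsf{kl}_c$, $\mathsf{em}^A_c$ described exist and are unique. *)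

theory Defs
  imports Main
begin

section \<open>Categories, functors, natural transformations\<close>

text \<open>Objects and arrows are carried by sets over arbitrary types; every arrow determines its domain
  and codomain. Composition is written in the usual order: \<open>g \<cdot> f\<close> is \<open>g\<close> after \<open>f\<close>.\<close>

record ('o, 'm) category =
  Obj :: "'o set"
  Arr :: "'m set"
  Dom :: "'m \<Rightarrow> 'o"
  Cod :: "'m \<Rightarrow> 'o"
  Id :: "'o \<Rightarrow> 'm"
  Comp :: "'m \<Rightarrow> 'm \<Rightarrow> 'm"  (infixr "\<cdot>\<index>" 70)

definition Hom :: "('o, 'm) category \<Rightarrow> 'o \<Rightarrow> 'o \<Rightarrow> 'm set" where
  "Hom C X Y = {f \<in> Arr C. Dom C f = X \<and> Cod C f = Y}"

locale category =
  fixes C :: "('o, 'm) category" (structure)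
  assumes Dom_closed: "f \<in> Arr C \<Longrightarrow> Dom C f \<in> Obj C"
    and Cod_closed: "f \<in> Arr C \<Longrightarrow> Cod C f \<in> Obj C"
    and Id_closed: "X \<in> Obj C \<Longrightarrow> Id C X \<in> Hom C X X"
    and Comp_closed: "f \<in> Hom C X Y \<Longrightarrow> g \<in> Hom C Y Z \<Longrightarrow> g \<cdot> f \<in> Hom C X Z"
    and Id_left: "f \<in> Hom C X Y \<Longrightarrow> Id C Y \<cdot> f = f"
    and Id_right: "f \<in> Hom C X Y \<Longrightarrow> f \<cdot> Id C X = f"
    and Comp_assoc: "f \<in> Hom C W X \<Longrightarrow> g \<in> Hom C X Y \<Longrightarrow> h \<in> Hom C Y Z
      \<Longrightarrow> (h \<cdot> g) \<cdot> f = h \<cdot> (g \<cdot> f)"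

text \<open>Meaningful only for isomorphisms, such as the structure maps of initial algebras and of final
  coalgebras (Lambek's lemma).\<close>

definition inverse_arr :: "('o, 'm) category \<Rightarrow> 'm \<Rightarrow> 'm" where
  "inverse_arr C f = (THE g. g \<in> Hom C (Cod C f) (Dom C f)
     \<and> g \<cdot>\<^bsub>C\<^esub> f = Id C (Dom C f) \<and> f \<cdot>\<^bsub>C\<^esub> g = Id C (Cod C f))"

record ('o, 'm, 'p, 'n) functor_map =
  omap :: "'o \<Rightarrow> 'p"
  amap :: "'m \<Rightarrow> 'n"

locale is_functor = source: category C + target: category D
  for C :: "('o, 'm) category" and D :: "('p, 'n) category" +
  fixes F :: "('o, 'm, 'p, 'n) functor_map"
  assumes omap_closed: "X \<in> Obj C \<Longrightarrow> omap F X \<in> Obj D"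
    and amap_closed: "f \<in> Hom C X Y \<Longrightarrow> amap F f \<in> Hom D (omap F X) (omap F Y)"
    and amap_Id: "X \<in> Obj C \<Longrightarrow> amap F (Id C X) = Id D (omap F X)"
    and amap_Comp: "f \<in> Hom C X Y \<Longrightarrow> g \<in> Hom C Y Z
      \<Longrightarrow> amap F (g \<cdot>\<^bsub>C\<^esub> f) = amap F g \<cdot>\<^bsub>D\<^esub> amap F f"

abbreviation endofunctor :: "('o, 'm) category \<Rightarrow> ('o, 'm, 'o, 'm) functor_map \<Rightarrow> bool" where
  "endofunctor C F \<equiv> is_functor C C F"

definition id_functor :: "('o, 'm, 'o, 'm) functor_map" where
  "id_functor = \<lparr>omap = (\<lambda>X. X), amap = (\<lambda>f. f)\<rparr>"

definition comp_functor ::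
  "('p, 'n, 'q, 'k) functor_map \<Rightarrow> ('o, 'm, 'p, 'n) functor_map \<Rightarrow> ('o, 'm, 'q, 'k) functor_map"
  (infixr "\<circ>\<^sub>F" 75) where
  "G \<circ>\<^sub>F F = \<lparr>omap = (\<lambda>X. omap G (omap F X)), amap = (\<lambda>f. amap G (amap F f))\<rparr>"

locale nat_trans = F: is_functor C D F + G: is_functor C D G
  for C :: "('o, 'm) category" and D :: "('p, 'n) category"
    and F G :: "('o, 'm, 'p, 'n) functor_map" +
  fixes \<tau> :: "'o \<Rightarrow> 'n"
  assumes component: "X \<in> Obj C \<Longrightarrow> \<tau> X \<in> Hom D (omap F X) (omap G X)"
    and naturality: "f \<in> Hom C X Y \<Longrightarrow> \<tau> Y \<cdot>\<^bsub>D\<^esub> amap F f = amap G f \<cdot>\<^bsub>D\<^esub> \<tau> X"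


section \<open>Algebras and coalgebras of an endofunctor\<close>

definition initial_algebra ::
  "('o, 'm) category \<Rightarrow> ('o, 'm, 'o, 'm) functor_map \<Rightarrow> 'o \<Rightarrow> 'm \<Rightarrow> bool" where
  "initial_algebra C F I i \<longleftrightarrow> I \<in> Obj C \<and> i \<in> Hom C (omap F I) I \<and>
     (\<forall>X\<in>Obj C. \<forall>x\<in>Hom C (omap F X) X.
        \<exists>!h. h \<in> Hom C I X \<and> h \<cdot>\<^bsub>C\<^esub> i = x \<cdot>\<^bsub>C\<^esub> amap F h)"

definition final_coalgebra ::
  "('o, 'm) category \<Rightarrow> ('o, 'm, 'o, 'm) functor_map \<Rightarrow> 'o \<Rightarrow> 'm \<Rightarrow> bool" where
  "final_coalgebra C F Z z \<longleftrightarrow> Z \<in> Obj C \<and> z \<in> Hom C Z (omap F Z) \<and>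
     (\<forall>X\<in>Obj C. \<forall>x\<in>Hom C X (omap F X).
        \<exists>!h. h \<in> Hom C X Z \<and> z \<cdot>\<^bsub>C\<^esub> h = amap F h \<cdot>\<^bsub>C\<^esub> x)"

text \<open>The unique coalgebra-to-algebra map from \<open>c : X \<rightarrow> F(X)\<close> to \<open>l : F(Y) \<rightarrow> Y\<close>; it is meaningful
  when the algebra is corecursive.\<close>

definition coalg_to_alg ::
  "('o, 'm) category \<Rightarrow> ('o, 'm, 'o, 'm) functor_map \<Rightarrow> 'o \<Rightarrow> 'm \<Rightarrow> 'o \<Rightarrow> 'm \<Rightarrow> 'm" where
  "coalg_to_alg C F X c Y l = (THE h. h \<in> Hom C X Y \<and> h = l \<cdot>\<^bsub>C\<^esub> amap F h \<cdot>\<^bsub>C\<^esub> c)"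


section \<open>Monads and their Eilenberg-Moore and Kleisli categories\<close>

locale monad = T: is_functor C C T
    + unit: nat_trans C C id_functor T \<eta> + mult: nat_trans C C "T \<circ>\<^sub>F T" T \<mu>
  for C :: "('o, 'm) category" (structure) and T :: "('o, 'm, 'o, 'm) functor_map"
    and \<eta> \<mu> :: "'o \<Rightarrow> 'm" +
  assumes unit_left: "X \<in> Obj C \<Longrightarrow> \<mu> X \<cdot> \<eta> (omap T X) = Id C (omap T X)"
    and unit_right: "X \<in> Obj C \<Longrightarrow> \<mu> X \<cdot> amap T (\<eta> X) = Id C (omap T X)"
    and mult_assoc: "X \<in> Obj C \<Longrightarrow> \<mu> X \<cdot> \<mu> (omap T X) = \<mu> X \<cdot> amap T (\<mu> X)"

definition em_algebras ::
  "('o, 'm) category \<Rightarrow> ('o, 'm, 'o, 'm) functor_map \<Rightarrow> ('o \<Rightarrow> 'm) \<Rightarrow> ('o \<Rightarrow> 'm) \<Rightarrow> ('o \<times> 'm) set"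
  where
  "em_algebras C T \<eta> \<mu> = {(Y, b). Y \<in> Obj C \<and> b \<in> Hom C (omap T Y) Y
     \<and> b \<cdot>\<^bsub>C\<^esub> \<eta> Y = Id C Y \<and> b \<cdot>\<^bsub>C\<^esub> \<mu> Y = b \<cdot>\<^bsub>C\<^esub> amap T b}"

text \<open>Arrows of the Eilenberg-Moore and Kleisli categories are tagged with their source and target.\<close>

type_synonym ('o, 'm) em_arr = "('o \<times> 'm) \<times> ('o \<times> 'm) \<times> 'm"

definition EM ::
  "('o, 'm) category \<Rightarrow> ('o, 'm, 'o, 'm) functor_map \<Rightarrow> ('o \<Rightarrow> 'm) \<Rightarrow> ('o \<Rightarrow> 'm)
     \<Rightarrow> ('o \<times> 'm, ('o, 'm) em_arr) category" where
  "EM C T \<eta> \<mu> =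
     \<lparr>Obj = em_algebras C T \<eta> \<mu>,
      Arr = {((Y, b), (Z, d), f). (Y, b) \<in> em_algebras C T \<eta> \<mu> \<and> (Z, d) \<in> em_algebras C T \<eta> \<mu>
               \<and> f \<in> Hom C Y Z \<and> f \<cdot>\<^bsub>C\<^esub> b = d \<cdot>\<^bsub>C\<^esub> amap T f},
      Dom = (\<lambda>(P, Q, f). P),
      Cod = (\<lambda>(P, Q, f). Q),
      Id = (\<lambda>P. (P, P, Id C (fst P))),
      Comp = (\<lambda>(Q', R, g) (P, Q, f). (P, R, g \<cdot>\<^bsub>C\<^esub> f))\<rparr>"

definition em_forget :: "('o \<times> 'm, ('o, 'm) em_arr, 'o, 'm) functor_map" where
  "em_forget = \<lparr>omap = fst, amap = (\<lambda>(P, Q, f). f)\<rparr>"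

definition em_free ::
  "('o, 'm) category \<Rightarrow> ('o, 'm, 'o, 'm) functor_map \<Rightarrow> ('o \<Rightarrow> 'm)
     \<Rightarrow> ('o, 'm, 'o \<times> 'm, ('o, 'm) em_arr) functor_map" where
  "em_free C T \<mu> =
     \<lparr>omap = (\<lambda>X. (omap T X, \<mu> X)),
      amap = (\<lambda>f. ((omap T (Dom C f), \<mu> (Dom C f)), (omap T (Cod C f), \<mu> (Cod C f)), amap T f))\<rparr>"

type_synonym ('o, 'm) kl_arr = "'o \<times> 'o \<times> 'm"

definition Kl ::
  "('o, 'm) category \<Rightarrow> ('o, 'm, 'o, 'm) functor_map \<Rightarrow> ('o \<Rightarrow> 'm) \<Rightarrow> ('o \<Rightarrow> 'm)
     \<Rightarrow> ('o, ('o, 'm) kl_arr) category" where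
  "Kl C T \<eta> \<mu> =
     \<lparr>Obj = Obj C,
      Arr = {(X, Y, f). X \<in> Obj C \<and> Y \<in> Obj C \<and> f \<in> Hom C X (omap T Y)},
      Dom = (\<lambda>(X, Y, f). X),
      Cod = (\<lambda>(X, Y, f). Y),
      Id = (\<lambda>X. (X, X, \<eta> X)),
      Comp = (\<lambda>(Y', Z, g) (X, Y, f). (X, Z, \<mu> Z \<cdot>\<^bsub>C\<^esub> amap T g \<cdot>\<^bsub>C\<^esub> f))\<rparr>"

definition kl_J ::
  "('o, 'm) category \<Rightarrow> ('o \<Rightarrow> 'm) \<Rightarrow> ('o, 'm, 'o, ('o, 'm) kl_arr) functor_map" where
  "kl_J C \<eta> =
     \<lparr>omap = (\<lambda>X. X), amap = (\<lambda>f. (Dom C f, Cod C f, \<eta> (Cod C f) \<cdot>\<^bsub>C\<^esub> f))\<rparr>"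


section \<open>Distributive laws\<close>

locale kleisli_law = monad C T \<eta> \<mu> + A: is_functor C C A
    + law: nat_trans C C "A \<circ>\<^sub>F T" "T \<circ>\<^sub>F A" lam
  for C :: "('o, 'm) category" (structure) and T \<eta> \<mu> and A :: "('o, 'm, 'o, 'm) functor_map"
    and lam :: "'o \<Rightarrow> 'm" +
  assumes law_unit: "X \<in> Obj C \<Longrightarrow> lam X \<cdot> amap A (\<eta> X) = \<eta> (omap A X)"
    and law_mult: "X \<in> Obj C \<Longrightarrow>
      lam X \<cdot> amap A (\<mu> X) = \<mu> (omap A X) \<cdot> amap T (lam X) \<cdot> lam (omap T X)"

definition kl_extension ::
  "('o, 'm) category \<Rightarrow> ('o, 'm, 'o, 'm) functor_map \<Rightarrow> ('o \<Rightarrow> 'm)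
     \<Rightarrow> ('o, ('o, 'm) kl_arr, 'o, ('o, 'm) kl_arr) functor_map" where
  "kl_extension C A lam =
     \<lparr>omap = omap A,
      amap = (\<lambda>(X, Y, f). (omap A X, omap A Y, lam Y \<cdot>\<^bsub>C\<^esub> amap A f))\<rparr>"

locale em_law = monad C T \<eta> \<mu> + B: is_functor C C B
    + law: nat_trans C C "T \<circ>\<^sub>F B" "B \<circ>\<^sub>F T" \<kappa>
  for C :: "('o, 'm) category" (structure) and T \<eta> \<mu> and B :: "('o, 'm, 'o, 'm) functor_map"
    and \<kappa> :: "'o \<Rightarrow> 'm" +
  assumes law_unit: "X \<in> Obj C \<Longrightarrow> \<kappa> X \<cdot> \<eta> (omap B X) = amap B (\<eta> X)"
    and law_mult: "X \<in> Obj C \<Longrightarrow>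
      \<kappa> X \<cdot> \<mu> (omap B X) = amap B (\<mu> X) \<cdot> \<kappa> (omap T X) \<cdot> amap T (\<kappa> X)"

definition em_lifting ::
  "('o, 'm) category \<Rightarrow> ('o, 'm, 'o, 'm) functor_map \<Rightarrow> ('o \<Rightarrow> 'm)
     \<Rightarrow> ('o \<times> 'm, ('o, 'm) em_arr, 'o \<times> 'm, ('o, 'm) em_arr) functor_map" where
  "em_lifting C B \<kappa> =
     (let lift = (\<lambda>(Y, b). (omap B Y, amap B b \<cdot>\<^bsub>C\<^esub> \<kappa> Y))
      in \<lparr>omap = lift, amap = (\<lambda>(P, Q, f). (lift P, lift Q, amap B f))\<rparr>)"

text \<open>The natural transformation \<open>TA \<Rightarrow> BT\<close> induced by \<open>\<rho> : AU \<Rightarrow> UB'\<close>, where \<open>B'\<close> is the lifting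
  of \<open>B\<close>: evaluate \<open>\<rho>\<close> at the free algebra \<open>(T(X), \<mu>\<^sub>X)\<close>.\<close>

definition rho2 ::
  "('o, 'm) category \<Rightarrow> ('o, 'm, 'o, 'm) functor_map \<Rightarrow> ('o \<Rightarrow> 'm) \<Rightarrow> ('o \<Rightarrow> 'm)
     \<Rightarrow> ('o, 'm, 'o, 'm) functor_map \<Rightarrow> ('o, 'm, 'o, 'm) functor_map \<Rightarrow> ('o \<Rightarrow> 'm)
     \<Rightarrow> ('o \<times> 'm \<Rightarrow> 'm) \<Rightarrow> 'o \<Rightarrow> 'm" where
  "rho2 C T \<eta> \<mu> A B \<kappa> \<rho> X =
     amap B (\<mu> X) \<cdot>\<^bsub>C\<^esub> \<kappa> (omap T X) \<cdot>\<^bsub>C\<^esub> amap T (\<rho> (omap (em_free C T \<mu>) X))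
       \<cdot>\<^bsub>C\<^esub> amap T (amap A (\<eta> X))"

end

theory Submission
  imports Defs
begin

text \<open>
  Put \<open>r = \<zeta>\<^sup>-\<^sup>1 \<circ> \<rho>\<^bsub>(\<Theta>,a)\<^esub> : A(\<Theta>) \<rightarrow> \<Theta>\<close>. As \<open>a\<close> is a morphism of Eilenberg-Moore algebras from the free
  algebra on \<open>\<Theta>\<close> to \<open>(\<Theta>, a)\<close>, naturality of \<open>\<rho>\<close> collapses the algebra \<open>\<ell>\<^sub>e\<^sub>m\<close> to \<open>a \<circ> T(r)\<close>, and the
  compatibility of \<open>\<rho>\<close> with the two laws becomes \<open>r \<circ> A(a) = a \<circ> T(r) \<circ> \<lambda>\<^sub>\<Theta>\<close>. Together with
  \<open>k \<circ> \<beta> = r \<circ> A(k)\<close> this makes \<open>a \<circ> T(k)\<close> a morphism of \<open>TA\<close>-algebras, so it maps a solution for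
  \<open>\<ell>\<^sub>k\<^sub>l\<close> to a solution for \<open>\<ell>\<^sub>e\<^sub>m\<close>. The latter is unique: the extension \<open>a \<circ> T(h)\<close> of a solution \<open>h\<close>
  is a morphism from the \<open>B\<close>-coalgebra on \<open>T(X)\<close> that determinizes \<open>\<rho>\<^sub>2 \<circ> c\<close> to the final one.
\<close>

section \<open>Categories\<close>

lemma Hom_iff [simp]: "f \<in> Hom C X Y \<longleftrightarrow> f \<in> Arr C \<and> Dom C f = X \<and> Cod C f = Y"
  by (simp add: Hom_def)

lemma comp_functor_simps [simp]:
  "omap (G \<circ>\<^sub>F F) X = omap G (omap F X)"
  "amap (G \<circ>\<^sub>F F) f = amap G (amap F f)"
  by (simp_all add: comp_functor_def)

lemma id_functor_simps [simp]: "omap id_functor X = X" "amap id_functor f = f"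
  by (simp_all add: id_functor_def)

context category
begin

lemma Dom_Obj [simp]: "f \<in> Arr C \<Longrightarrow> Dom C f \<in> Obj C"
  by (rule Dom_closed)

lemma Cod_Obj [simp]: "f \<in> Arr C \<Longrightarrow> Cod C f \<in> Obj C"
  by (rule Cod_closed)

lemma Id_simps [simp]:
  assumes "X \<in> Obj C"
  shows "Id C X \<in> Arr C" "Dom C (Id C X) = X" "Cod C (Id C X) = X"
  using Id_closed[OF assms] by simp_all

lemma Comp_simps [simp]:
  assumes "f \<in> Arr C" "g \<in> Arr C" "Dom C g = Cod C f"
  shows "g \<cdot> f \<in> Arr C" "Dom C (g \<cdot> f) = Dom C f" "Cod C (g \<cdot> f) = Cod C g"
  using Comp_closed[of f "Dom C f" "Cod C f" g "Cod C g"] assms by simp_all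

lemma Id_Comp [simp]:
  "f \<in> Arr C \<Longrightarrow> Cod C f = Y \<Longrightarrow> Id C Y \<cdot> f = f"
  "f \<in> Arr C \<Longrightarrow> Dom C f = X \<Longrightarrow> f \<cdot> Id C X = f"
  by (auto intro: Id_left Id_right)

lemma Comp_Comp [simp]:
  "f \<in> Arr C \<Longrightarrow> g \<in> Arr C \<Longrightarrow> h \<in> Arr C \<Longrightarrow> Dom C g = Cod C f \<Longrightarrow> Dom C h = Cod C g
    \<Longrightarrow> (h \<cdot> g) \<cdot> f = h \<cdot> g \<cdot> f"
  by (rule Comp_assoc) simp_all

text \<open>Composites are normalized to the right by \<open>Comp_Comp\<close>, which hides a factor
  \<open>g \<cdot> f\<close> standing before a tail \<open>x\<close>. This form lets an equation for
  \<open>g \<cdot> f\<close> act inside a longer chain.\<close>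

lemma Comp_extend:
  assumes "g \<cdot> f = p" "x \<in> Arr C" "f \<in> Arr C" "g \<in> Arr C" "Dom C f = Cod C x" "Dom C g = Cod C f"
  shows "g \<cdot> f \<cdot> x = p \<cdot> x"
  using assms by (metis Comp_Comp)

lemma inverse_arr_eqI:
  assumes "f \<in> Hom C X Y" "g \<in> Hom C Y X" "g \<cdot> f = Id C X" "f \<cdot> g = Id C Y"
  shows "inverse_arr C f = g"
  unfolding inverse_arr_def
proof (rule the_equality)
  fix h assume h: "h \<in> Hom C (Cod C f) (Dom C f) \<and> h \<cdot> f = Id C (Dom C f) \<and> f \<cdot> h = Id C (Cod C f)"
  have "h = h \<cdot> f \<cdot> g" using assms h by simp
  also have "\<dots> = (h \<cdot> f) \<cdot> g" using assms h by (intro Comp_Comp[symmetric]) auto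
  also have "\<dots> = g" using assms h by simp
  finally show "h = g" .
qed (use assms in simp)

end

context is_functor
begin

lemma omap_Obj [simp]: "X \<in> Obj C \<Longrightarrow> omap F X \<in> Obj D"
  by (rule omap_closed)

lemma amap_simps [simp]:
  assumes "f \<in> Arr C"
  shows "amap F f \<in> Arr D" "Dom D (amap F f) = omap F (Dom C f)" "Cod D (amap F f) = omap F (Cod C f)"
  using amap_closed[of f "Dom C f" "Cod C f"] assms by simp_all

lemma amap_Id_simp [simp]: "X \<in> Obj C \<Longrightarrow> amap F (Id C X) = Id D (omap F X)"
  by (rule amap_Id)

lemma amap_Comp_simp [simp]:
  "f \<in> Arr C \<Longrightarrow> g \<in> Arr C \<Longrightarrow> Dom C g = Cod C f
    \<Longrightarrow> amap F (g \<cdot>\<^bsub>C\<^esub> f) = amap F g \<cdot>\<^bsub>D\<^esub> amap F f"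
  by (rule amap_Comp) simp_all

text \<open>Transports an equation between arrows along the functor, stated for images that
  \<open>amap_Comp_simp\<close> has already split.\<close>

lemma amap_Comp_eq:
  assumes "g \<cdot>\<^bsub>C\<^esub> f = p" "f \<in> Arr C" "g \<in> Arr C" "Dom C g = Cod C f"
  shows "amap F g \<cdot>\<^bsub>D\<^esub> amap F f = amap F p"
  using assms by (metis amap_Comp_simp)

end

context nat_trans
begin

lemma component_simps [simp]:
  assumes "X \<in> Obj C"
  shows "\<tau> X \<in> Arr D" "Dom D (\<tau> X) = omap F X" "Cod D (\<tau> X) = omap G X"
  using component[OF assms] by simp_all

lemma naturality_Arr:
  "f \<in> Arr C \<Longrightarrow> \<tau> (Cod C f) \<cdot>\<^bsub>D\<^esub> amap F f = amap G f \<cdot>\<^bsub>D\<^esub> \<tau> (Dom C f)"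
  by (rule naturality) simp

end

section \<open>Universal properties and Lambek's lemma\<close>

lemma final_coalgebra_ex1:
  assumes "final_coalgebra C F Z z" "X \<in> Obj C" "x \<in> Hom C X (omap F X)"
  shows "\<exists>!h. h \<in> Hom C X Z \<and> z \<cdot>\<^bsub>C\<^esub> h = amap F h \<cdot>\<^bsub>C\<^esub> x"
  using assms unfolding final_coalgebra_def by blast

lemma initial_algebra_ex1:
  assumes "initial_algebra C F I i" "X \<in> Obj C" "x \<in> Hom C (omap F X) X"
  shows "\<exists>!h. h \<in> Hom C I X \<and> h \<cdot>\<^bsub>C\<^esub> i = x \<cdot>\<^bsub>C\<^esub> amap F h"
  using assms unfolding initial_algebra_def by blast

lemma final_coalgebra_unique:
  assumes "final_coalgebra C F Z z" "X \<in> Obj C" "x \<in> Hom C X (omap F X)"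
    and "g \<in> Hom C X Z" "z \<cdot>\<^bsub>C\<^esub> g = amap F g \<cdot>\<^bsub>C\<^esub> x"
    and "h \<in> Hom C X Z" "z \<cdot>\<^bsub>C\<^esub> h = amap F h \<cdot>\<^bsub>C\<^esub> x"
  shows "g = h"
  using final_coalgebra_ex1[OF assms(1-3)] assms(4-7) by blast

lemma initial_algebra_unique:
  assumes "initial_algebra C F I i" "X \<in> Obj C" "x \<in> Hom C (omap F X) X"
    and "g \<in> Hom C I X" "g \<cdot>\<^bsub>C\<^esub> i = x \<cdot>\<^bsub>C\<^esub> amap F g"
    and "h \<in> Hom C I X" "h \<cdot>\<^bsub>C\<^esub> i = x \<cdot>\<^bsub>C\<^esub> amap F h"
  shows "g = h"
  using initial_algebra_ex1[OF assms(1-3)] assms(4-7) by blast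

text \<open>Lambek's lemma: \<open>F(z)\<close> is a coalgebra on \<open>F(Z)\<close>, and its
  unique morphism \<open>g\<close> to \<open>z\<close> is the inverse.\<close>

lemma final_coalgebra_inverse:
  assumes "endofunctor C F" "final_coalgebra C F Z z"
  shows "inverse_arr C z \<in> Hom C (omap F Z) Z"
    and "inverse_arr C z \<cdot>\<^bsub>C\<^esub> z = Id C Z"
    and "z \<cdot>\<^bsub>C\<^esub> inverse_arr C z = Id C (omap F Z)"
proof -
  interpret is_functor C C F by fact
  have z [simp]: "Z \<in> Obj C" "z \<in> Arr C" "Dom C z = Z" "Cod C z = omap F Z"
    using assms(2) by (auto simp: final_coalgebra_def)
  have "omap F Z \<in> Obj C" "amap F z \<in> Hom C (omap F Z) (omap F (omap F Z))" by simp_all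
  then obtain g where g: "g \<in> Hom C (omap F Z) Z" "z \<cdot>\<^bsub>C\<^esub> g = amap F g \<cdot>\<^bsub>C\<^esub> amap F z"
    using final_coalgebra_ex1[OF assms(2)] by blast
  then have [simp]: "g \<in> Arr C" "Dom C g = omap F Z" "Cod C g = Z" by simp_all
  \<comment> \<open>Both \<open>g \<cdot> z\<close> and the identity are coalgebra endomorphisms of
    \<open>z\<close>.\<close>
  have gz: "g \<cdot>\<^bsub>C\<^esub> z = Id C Z"
    by (rule final_coalgebra_unique[OF assms(2), where x = z])
      (simp_all add: source.Comp_extend[OF g(2)])
  \<comment> \<open>The morphism equation makes \<open>z \<cdot> g\<close> equal to
    \<open>F(g \<cdot> z)\<close>, the image of an identity.\<close>
  then have zg: "z \<cdot>\<^bsub>C\<^esub> g = Id C (omap F Z)"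
    using g(2) amap_Comp_eq[OF gz] by simp
  have "inverse_arr C z = g"
    by (rule source.inverse_arr_eqI[OF _ g(1) gz zg]) simp
  with g gz zg show "inverse_arr C z \<in> Hom C (omap F Z) Z"
    and "inverse_arr C z \<cdot>\<^bsub>C\<^esub> z = Id C Z"
    and "z \<cdot>\<^bsub>C\<^esub> inverse_arr C z = Id C (omap F Z)"
    by simp_all
qed

text \<open>The dual of the previous argument, with \<open>F(i)\<close> as an algebra on
  \<open>F(I)\<close>.\<close>

lemma initial_algebra_inverse:
  assumes "endofunctor C F" "initial_algebra C F I i"
  shows "inverse_arr C i \<in> Hom C I (omap F I)"
    and "inverse_arr C i \<cdot>\<^bsub>C\<^esub> i = Id C (omap F I)"
    and "i \<cdot>\<^bsub>C\<^esub> inverse_arr C i = Id C I"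
proof -
  interpret is_functor C C F by fact
  have i [simp]: "I \<in> Obj C" "i \<in> Arr C" "Cod C i = I" "Dom C i = omap F I"
    using assms(2) by (auto simp: initial_algebra_def)
  have "omap F I \<in> Obj C" "amap F i \<in> Hom C (omap F (omap F I)) (omap F I)" by simp_all
  then obtain g where g: "g \<in> Hom C I (omap F I)" "g \<cdot>\<^bsub>C\<^esub> i = amap F i \<cdot>\<^bsub>C\<^esub> amap F g"
    using initial_algebra_ex1[OF assms(2)] by blast
  then have [simp]: "g \<in> Arr C" "Dom C g = I" "Cod C g = omap F I" by simp_all
  have ig: "i \<cdot>\<^bsub>C\<^esub> g = Id C I"
    by (rule initial_algebra_unique[OF assms(2), where x = i]) (simp_all add: g(2))
  then have gi: "g \<cdot>\<^bsub>C\<^esub> i = Id C (omap F I)"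
    using g(2) amap_Comp_eq[OF ig] by simp
  have "inverse_arr C i = g"
    by (rule source.inverse_arr_eqI[OF _ g(1) gi ig]) simp
  with g gi ig show "inverse_arr C i \<in> Hom C I (omap F I)"
    and "inverse_arr C i \<cdot>\<^bsub>C\<^esub> i = Id C (omap F I)"
    and "i \<cdot>\<^bsub>C\<^esub> inverse_arr C i = Id C I"
    by simp_all
qed

lemma coalg_to_alg_eqI:
  assumes "h \<in> Hom C X Y" "h = l \<cdot>\<^bsub>C\<^esub> amap F h \<cdot>\<^bsub>C\<^esub> c"
    and "\<And>g. g \<in> Hom C X Y \<Longrightarrow> g = l \<cdot>\<^bsub>C\<^esub> amap F g \<cdot>\<^bsub>C\<^esub> c \<Longrightarrow> g = h"
  shows "coalg_to_alg C F X c Y l = h"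
  unfolding coalg_to_alg_def using assms by (intro the_equality) blast+

section \<open>Solutions in the Kleisli category\<close>

context kleisli_law
begin

text \<open>Read in the Kleisli category, \<open>c\<close> is a coalgebra from \<open>X\<close> to
  \<open>A(X)\<close>. Its morphisms to the final coalgebra are exactly the solutions, because
  \<open>T(\<beta>)\<close> is invertible.\<close>

lemma kl_solution_ex1:
  assumes init: "initial_algebra C A \<Psi> \<beta>"
    and final: "final_coalgebra (Kl C T \<eta> \<mu>) (kl_extension C A lam) \<Psi>
      (amap (kl_J C \<eta>) (inverse_arr C \<beta>))"
    and X [simp]: "X \<in> Obj C" and c: "c \<in> Hom C X (omap T (omap A X))"
  shows "\<exists>!h. h \<in> Hom C X (omap T \<Psi>) \<and>
    h = (amap T \<beta> \<cdot> \<mu> (omap A \<Psi>) \<cdot> amap T (lam \<Psi>)) \<cdot> amap T (amap A h) \<cdot> c"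
proof -
  define b where "b = inverse_arr C \<beta>"
  have \<beta> [simp]: "\<Psi> \<in> Obj C" "\<beta> \<in> Arr C" "Dom C \<beta> = omap A \<Psi>" "Cod C \<beta> = \<Psi>"
    using init by (simp_all add: initial_algebra_def)
  have b: "b \<cdot> \<beta> = Id C (omap A \<Psi>)" "\<beta> \<cdot> b = Id C \<Psi>"
    and [simp]: "b \<in> Arr C" "Dom C b = \<Psi>" "Cod C b = omap A \<Psi>"
    using initial_algebra_inverse[OF A.is_functor_axioms init] by (simp_all add: b_def)
  have [simp]: "c \<in> Arr C" "Dom C c = X" "Cod C c = omap T (omap A X)"
    using c by simp_all
  note Tb = T.amap_Comp_eq[OF b(1)] T.amap_Comp_eq[OF b(2)]
  have hom: "(X, \<Psi>, h) \<in> Hom (Kl C T \<eta> \<mu>) X \<Psi> \<longleftrightarrow> h \<in> Hom C X (omap T \<Psi>)" for h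
    by (auto simp: Kl_def)
  have eq: "amap (kl_J C \<eta>) b \<cdot>\<^bsub>Kl C T \<eta> \<mu>\<^esub> (X, \<Psi>, h)
        = amap (kl_extension C A lam) (X, \<Psi>, h) \<cdot>\<^bsub>Kl C T \<eta> \<mu>\<^esub> (X, omap A X, c)
      \<longleftrightarrow> h = (amap T \<beta> \<cdot> \<mu> (omap A \<Psi>) \<cdot> amap T (lam \<Psi>)) \<cdot> amap T (amap A h) \<cdot> c"
    (is "?L \<longleftrightarrow> h = ?r") if "h \<in> Hom C X (omap T \<Psi>)" for h
  proof -
    have [simp]: "h \<in> Arr C" "Dom C h = X" "Cod C h = omap T \<Psi>" using that by simp_all
    define m where "m = \<mu> (omap A \<Psi>) \<cdot> amap T (lam \<Psi>) \<cdot> amap T (amap A h) \<cdot> c"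
    have [simp]: "m \<in> Arr C" "Dom C m = X" "Cod C m = omap T (omap A \<Psi>)"
      by (simp_all add: m_def)
    \<comment> \<open>The unit that \<open>J\<close> puts in front of \<open>b\<close> is absorbed
      by Kleisli composition, so one side of the morphism equation is just
      \<open>T(b) \<cdot> h\<close>.\<close>
    have "\<mu> (omap A \<Psi>) \<cdot> amap T (\<eta> (omap A \<Psi>)) \<cdot> amap T b \<cdot> h = amap T b \<cdot> h"
      by (simp add: T.source.Comp_extend[OF unit_right])
    then have "?L \<longleftrightarrow> amap T b \<cdot> h = m"
      by (simp add: Kl_def kl_J_def kl_extension_def m_def)
    \<comment> \<open>\<open>T(b)\<close> and \<open>T(\<beta>)\<close> are mutually inverse, so
      \<open>T(b)\<close> can be moved to the other side.\<close>
    also have "\<dots> \<longleftrightarrow> h = amap T \<beta> \<cdot> m"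
      using T.source.Comp_extend[OF Tb(1), of m] T.source.Comp_extend[OF Tb(2), of h] by auto
    also have "amap T \<beta> \<cdot> m = ?r"
      by (simp add: m_def)
    finally show ?thesis .
  qed
  have "X \<in> Obj (Kl C T \<eta> \<mu>)"
    "(X, omap A X, c) \<in> Hom (Kl C T \<eta> \<mu>) X (omap (kl_extension C A lam) X)"
    by (simp_all add: Kl_def kl_extension_def)
  then have "\<exists>!u. u \<in> Hom (Kl C T \<eta> \<mu>) X \<Psi> \<and>
      amap (kl_J C \<eta>) b \<cdot>\<^bsub>Kl C T \<eta> \<mu>\<^esub> u
        = amap (kl_extension C A lam) u \<cdot>\<^bsub>Kl C T \<eta> \<mu>\<^esub> (X, omap A X, c)" (is "\<exists>!u. ?P u")
    using final_coalgebra_ex1[OF final] unfolding b_def by blast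
  then obtain u where u: "?P u" "\<And>v. ?P v \<Longrightarrow> v = u" by blast
  \<comment> \<open>Kleisli arrows carry their source and target, so \<open>u\<close> is determined
    by its underlying arrow \<open>h\<close>.\<close>
  obtain h where h: "u = (X, \<Psi>, h)" using u(1) by (cases u) (auto simp: Kl_def)
  show ?thesis
  proof (rule ex1I[of _ h])
    show "h \<in> Hom C X (omap T \<Psi>) \<and>
        h = (amap T \<beta> \<cdot> \<mu> (omap A \<Psi>) \<cdot> amap T (lam \<Psi>)) \<cdot> amap T (amap A h) \<cdot> c"
      using u(1) hom eq unfolding h by blast
  next
    fix g assume "g \<in> Hom C X (omap T \<Psi>) \<and>
        g = (amap T \<beta> \<cdot> \<mu> (omap A \<Psi>) \<cdot> amap T (lam \<Psi>)) \<cdot> amap T (amap A g) \<cdot> c"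
    then have "(X, \<Psi>, g) = u" using u(2) hom eq by blast
    then show "g = h" by (simp add: h)
  qed
qed

end

section \<open>The Eilenberg-Moore structure of the final coalgebra\<close>

locale em_law_final = em_law C T \<eta> \<mu> B \<kappa>
  for C :: "('o, 'm) category" (structure) and T \<eta> \<mu> B \<kappa> +
  fixes \<Theta> :: 'o and \<zeta> a :: 'm
  assumes final: "final_coalgebra C B \<Theta> \<zeta>"
    and a_def: "a = (THE f. f \<in> Hom C (omap T \<Theta>) \<Theta> \<and> \<zeta> \<cdot> f = amap B f \<cdot> \<kappa> \<Theta> \<cdot> amap T \<zeta>)"
begin

abbreviation \<zeta>' :: 'm where
  "\<zeta>' \<equiv> inverse_arr C \<zeta>"

lemma \<zeta>_simps [simp]: "\<Theta> \<in> Obj C" "\<zeta> \<in> Arr C" "Dom C \<zeta> = \<Theta>" "Cod C \<zeta> = omap B \<Theta>"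
  using final by (simp_all add: final_coalgebra_def)

lemma \<zeta>'_simps [simp]: "\<zeta>' \<in> Arr C" "Dom C \<zeta>' = omap B \<Theta>" "Cod C \<zeta>' = \<Theta>"
  and \<zeta>_inverse: "\<zeta>' \<cdot> \<zeta> = Id C \<Theta>" "\<zeta> \<cdot> \<zeta>' = Id C (omap B \<Theta>)"
  using final_coalgebra_inverse[OF B.is_functor_axioms final] by simp_all

text \<open>The definite description denotes, since
  \<open>\<kappa> \<Theta> \<cdot> amap T \<zeta>\<close> is a \<open>B\<close>-coalgebra on
  \<open>T(\<Theta>)\<close> and \<zeta> is final.\<close>

lemma a_spec: "a \<in> Hom C (omap T \<Theta>) \<Theta> \<and> \<zeta> \<cdot> a = amap B a \<cdot> \<kappa> \<Theta> \<cdot> amap T \<zeta>"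
proof -
  have "omap T \<Theta> \<in> Obj C" "\<kappa> \<Theta> \<cdot> amap T \<zeta> \<in> Hom C (omap T \<Theta>) (omap B (omap T \<Theta>))"
    by simp_all
  then have "\<exists>!f. f \<in> Hom C (omap T \<Theta>) \<Theta> \<and> \<zeta> \<cdot> f = amap B f \<cdot> \<kappa> \<Theta> \<cdot> amap T \<zeta>"
    by (rule final_coalgebra_ex1[OF final])
  then show ?thesis unfolding a_def by (rule theI')
qed

lemma a_simps [simp]: "a \<in> Arr C" "Dom C a = omap T \<Theta>" "Cod C a = \<Theta>"
  using a_spec by simp_all

lemma \<zeta>_a: "\<zeta> \<cdot> a = amap B a \<cdot> \<kappa> \<Theta> \<cdot> amap T \<zeta>"
  using a_spec by simp

lemma \<kappa>_nat: "f \<in> Arr C \<Longrightarrow> Dom C f = X \<Longrightarrow> Cod C f = Y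
    \<Longrightarrow> \<kappa> Y \<cdot> amap T (amap B f) = amap B (amap T f) \<cdot> \<kappa> X"
  using law.naturality_Arr[of f] by simp

lemma \<eta>_nat: "f \<in> Arr C \<Longrightarrow> Dom C f = X \<Longrightarrow> Cod C f = Y \<Longrightarrow> \<eta> Y \<cdot> f = amap T f \<cdot> \<eta> X"
  using unit.naturality_Arr[of f] by simp

lemma \<mu>_nat: "f \<in> Arr C \<Longrightarrow> Dom C f = X \<Longrightarrow> Cod C f = Y
    \<Longrightarrow> \<mu> Y \<cdot> amap T (amap T f) = amap T f \<cdot> \<mu> X"
  using mult.naturality_Arr[of f] by simp

text \<open>By naturality of \<eta> and the unit law of \<kappa>, both sides are coalgebra
  endomorphisms of \<zeta>.\<close>

lemma a_unit: "a \<cdot> \<eta> \<Theta> = Id C \<Theta>"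
proof (rule final_coalgebra_unique[OF final, where x = \<zeta>])
  have "\<zeta> \<cdot> a \<cdot> \<eta> \<Theta> = amap B a \<cdot> \<kappa> \<Theta> \<cdot> amap T \<zeta> \<cdot> \<eta> \<Theta>"
    by (simp add: T.source.Comp_extend[OF \<zeta>_a])
  also have "\<dots> = amap B a \<cdot> \<kappa> \<Theta> \<cdot> \<eta> (omap B \<Theta>) \<cdot> \<zeta>"
    by (simp add: \<eta>_nat[of \<zeta>])
  also have "\<dots> = amap B (a \<cdot> \<eta> \<Theta>) \<cdot> \<zeta>"
    by (simp add: T.source.Comp_extend[OF law_unit])
  finally show "\<zeta> \<cdot> a \<cdot> \<eta> \<Theta> = amap B (a \<cdot> \<eta> \<Theta>) \<cdot> \<zeta>" .
qed simp_all

text \<open>Both sides are coalgebra morphisms to \<zeta> from the coalgebra on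
  \<open>T(T(\<Theta>))\<close> obtained from \<zeta> by applying \<open>T\<close> and then
  \<kappa>, twice over. The left side uses the multiplication law of \<kappa>, the right side its
  naturality.\<close>

lemma a_mult: "a \<cdot> \<mu> \<Theta> = a \<cdot> amap T a"
proof (rule final_coalgebra_unique[OF final,
      where x = "\<kappa> (omap T \<Theta>) \<cdot> amap T (\<kappa> \<Theta>) \<cdot> amap T (amap T \<zeta>)"])
  have "\<zeta> \<cdot> a \<cdot> \<mu> \<Theta> = amap B a \<cdot> \<kappa> \<Theta> \<cdot> amap T \<zeta> \<cdot> \<mu> \<Theta>"
    by (simp add: T.source.Comp_extend[OF \<zeta>_a])
  also have "\<dots> = amap B a \<cdot> \<kappa> \<Theta> \<cdot> \<mu> (omap B \<Theta>) \<cdot> amap T (amap T \<zeta>)"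
    by (simp add: \<mu>_nat[of \<zeta>])
  also have "\<dots> = amap B (a \<cdot> \<mu> \<Theta>) \<cdot> \<kappa> (omap T \<Theta>) \<cdot> amap T (\<kappa> \<Theta>) \<cdot> amap T (amap T \<zeta>)"
    by (simp add: T.source.Comp_extend[OF law_mult])
  finally show "\<zeta> \<cdot> a \<cdot> \<mu> \<Theta>
    = amap B (a \<cdot> \<mu> \<Theta>) \<cdot> \<kappa> (omap T \<Theta>) \<cdot> amap T (\<kappa> \<Theta>) \<cdot> amap T (amap T \<zeta>)" .
next
  have "\<zeta> \<cdot> a \<cdot> amap T a = amap B a \<cdot> \<kappa> \<Theta> \<cdot> amap T (\<zeta> \<cdot> a)"
    by (simp add: T.source.Comp_extend[OF \<zeta>_a] del: T.amap_Comp_simp) simp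
  also have "\<dots> = amap B a \<cdot> \<kappa> \<Theta> \<cdot> amap T (amap B a) \<cdot> amap T (\<kappa> \<Theta>) \<cdot> amap T (amap T \<zeta>)"
    by (simp add: \<zeta>_a del: T.amap_Comp_simp) simp
  also have "\<dots> = amap B (a \<cdot> amap T a) \<cdot> \<kappa> (omap T \<Theta>) \<cdot> amap T (\<kappa> \<Theta>) \<cdot> amap T (amap T \<zeta>)"
    by (simp add: T.source.Comp_extend[OF \<kappa>_nat])
  finally show "\<zeta> \<cdot> a \<cdot> amap T a
    = amap B (a \<cdot> amap T a) \<cdot> \<kappa> (omap T \<Theta>) \<cdot> amap T (\<kappa> \<Theta>) \<cdot> amap T (amap T \<zeta>)" .
qed simp_all

lemma a_em_algebra: "(\<Theta>, a) \<in> em_algebras C T \<eta> \<mu>"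
  by (simp add: em_algebras_def a_unit a_mult)

lemma free_em_algebra: "X \<in> Obj C \<Longrightarrow> (omap T X, \<mu> X) \<in> em_algebras C T \<eta> \<mu>"
  by (simp add: em_algebras_def unit_left mult_assoc)

text \<open>By \<open>\<zeta>_a\<close>, \<zeta> is an algebra morphism from
  \<open>(\<Theta>, a)\<close> to its lifting under \<open>B\<close>; hence so is its inverse, in
  the opposite direction.\<close>

lemma \<zeta>'_a: "\<zeta>' \<cdot> amap B a \<cdot> \<kappa> \<Theta> = a \<cdot> amap T \<zeta>'"
proof -
  have "a \<cdot> amap T \<zeta>' = \<zeta>' \<cdot> (\<zeta> \<cdot> a) \<cdot> amap T \<zeta>'"
    by (simp add: T.source.Comp_extend[OF \<zeta>_inverse(1)])
  also have "\<dots> = \<zeta>' \<cdot> amap B a \<cdot> \<kappa> \<Theta> \<cdot> amap T \<zeta> \<cdot> amap T \<zeta>'"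
    unfolding \<zeta>_a by simp
  also have "\<dots> = \<zeta>' \<cdot> amap B a \<cdot> \<kappa> \<Theta>"
    by (simp add: T.amap_Comp_eq[OF \<zeta>_inverse(2)])
  finally show ?thesis by simp
qed

text \<open>These are the properties of the extension of \<open>h\<close> along the free algebra on
  \<open>X\<close>: it is an algebra morphism to \<open>(\<Theta>, a)\<close>, and it restricts to
  \<open>h\<close> along the unit.\<close>

lemma extension_em_morphism:
  assumes "h \<in> Hom C X \<Theta>"
  shows "(a \<cdot> amap T h) \<cdot> \<mu> X = a \<cdot> amap T (a \<cdot> amap T h)"
    and "(a \<cdot> amap T h) \<cdot> \<eta> X = h"
proof -
  have X [simp]: "X \<in> Obj C" "h \<in> Arr C" "Dom C h = X" "Cod C h = \<Theta>"
    using assms by auto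
  show "(a \<cdot> amap T h) \<cdot> \<mu> X = a \<cdot> amap T (a \<cdot> amap T h)"
    using T.source.Comp_extend[OF a_mult, of "amap T (amap T h)"] by (simp add: \<mu>_nat)
  show "(a \<cdot> amap T h) \<cdot> \<eta> X = h"
    using T.source.Comp_extend[OF a_unit, of h] by (simp add: \<eta>_nat)
qed

end

section \<open>Comparison of the two semantics\<close>

locale em_extension = em_law_final C T \<eta> \<mu> B \<kappa> \<Theta> \<zeta> a + A: is_functor C C A
    + rho: nat_trans "EM C T \<eta> \<mu>" C "A \<circ>\<^sub>F em_forget" "em_forget \<circ>\<^sub>F em_lifting C B \<kappa>" \<rho>
  for C :: "('o, 'm) category" (structure) and T \<eta> \<mu> B \<kappa> \<Theta> \<zeta> a A \<rho>
begin

lemma \<rho>_simps [simp]: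
  assumes "(Y, b) \<in> em_algebras C T \<eta> \<mu>"
  shows "\<rho> (Y, b) \<in> Arr C" "Dom C (\<rho> (Y, b)) = omap A Y" "Cod C (\<rho> (Y, b)) = omap B Y"
  using rho.component[of "(Y, b)"] assms by (simp_all add: EM_def em_forget_def em_lifting_def Let_def)

lemma \<rho>_nat:
  assumes "(Y, b) \<in> em_algebras C T \<eta> \<mu>" "(Z, d) \<in> em_algebras C T \<eta> \<mu>"
    and "f \<in> Hom C Y Z" "f \<cdot> b = d \<cdot> amap T f"
  shows "\<rho> (Z, d) \<cdot> amap A f = amap B f \<cdot> \<rho> (Y, b)"
  using rho.naturality[of "((Y, b), (Z, d), f)" "(Y, b)" "(Z, d)"] assms
  by (simp add: EM_def em_forget_def em_lifting_def Let_def)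

definition r :: 'm where
  "r = \<zeta>' \<cdot> \<rho> (\<Theta>, a)"

lemma r_simps [simp]: "r \<in> Arr C" "Dom C r = omap A \<Theta>" "Cod C r = \<Theta>"
  by (simp_all add: r_def a_em_algebra)

text \<open>\<open>\<zeta>'_a\<close> moves the inverse of \<zeta> out of the argument of
  \<open>T\<close>, to the front where \<zeta> can cancel it.\<close>

lemma a_r: "a \<cdot> amap T r = \<zeta>' \<cdot> amap B a \<cdot> \<kappa> \<Theta> \<cdot> amap T (\<rho> (\<Theta>, a))"
proof -
  have "a \<cdot> amap T r = (a \<cdot> amap T \<zeta>') \<cdot> amap T (\<rho> (\<Theta>, a))"
    by (simp add: r_def a_em_algebra)
  also have "\<dots> = \<zeta>' \<cdot> amap B a \<cdot> \<kappa> \<Theta> \<cdot> amap T (\<rho> (\<Theta>, a))"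
    unfolding \<zeta>'_a[symmetric] by (simp add: a_em_algebra)
  finally show ?thesis .
qed

text \<open>The extension of \<open>h\<close> is an algebra morphism from the free algebra, so
  naturality of \<rho> replaces \<rho> at \<open>(T(X), \<mu> X)\<close> by \<rho> at
  \<open>(\<Theta>, a)\<close>. The unit inside \<open>rho2\<close> then restricts the extension
  back to \<open>h\<close>.\<close>

lemma rho2_extension:
  assumes "h \<in> Hom C X \<Theta>"
  shows "amap B (a \<cdot> amap T h) \<cdot> rho2 C T \<eta> \<mu> A B \<kappa> \<rho> X
    = amap B a \<cdot> \<kappa> \<Theta> \<cdot> amap T (\<rho> (\<Theta>, a)) \<cdot> amap T (amap A h)"
proof -
  define g where "g = a \<cdot> amap T h"
  let ?p = "\<rho> (omap T X, \<mu> X)"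
  have [simp]: "X \<in> Obj C" "h \<in> Arr C" "Dom C h = X" "Cod C h = \<Theta>"
    using assms by auto
  have [simp]: "g \<in> Arr C" "Dom C g = omap T X" "Cod C g = \<Theta>" by (simp_all add: g_def)
  note [simp] = free_em_algebra a_em_algebra
  have g: "g \<cdot> \<mu> X = a \<cdot> amap T g" "g \<cdot> \<eta> X = h"
    using extension_em_morphism[OF assms] by (simp_all only: g_def)
  have nat: "\<rho> (\<Theta>, a) \<cdot> amap A g = amap B g \<cdot> ?p"
    by (rule \<rho>_nat) (simp_all add: g)
  have "amap B g \<cdot> rho2 C T \<eta> \<mu> A B \<kappa> \<rho> X
      = amap B (g \<cdot> \<mu> X) \<cdot> \<kappa> (omap T X) \<cdot> amap T ?p \<cdot> amap T (amap A (\<eta> X))"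
    by (simp add: rho2_def em_free_def)
  \<comment> \<open>The algebra morphism law turns \<open>g \<cdot> \<mu> X\<close> into
    \<open>a \<cdot> T(g)\<close>, and naturality of \<kappa> carries \<open>B(T(g))\<close> across
    \<kappa> to meet \<rho>.\<close>
  also have "\<dots> = amap B a \<cdot> \<kappa> \<Theta> \<cdot> amap T (amap B g \<cdot> ?p) \<cdot> amap T (amap A (\<eta> X))"
    unfolding g by (simp add: T.source.Comp_extend[OF \<kappa>_nat])
  also have "\<dots> = amap B a \<cdot> \<kappa> \<Theta> \<cdot> amap T (\<rho> (\<Theta>, a)) \<cdot> amap T (amap A (g \<cdot> \<eta> X))"
    unfolding nat[symmetric] by simp
  finally show ?thesis unfolding g by (simp only: g_def)
qed

text \<open>The instance of \<open>rho2_extension\<close> at the identity, whose extension is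
  \<open>a\<close> itself.\<close>

lemma ell_em_eq: "\<zeta>' \<cdot> amap B a \<cdot> rho2 C T \<eta> \<mu> A B \<kappa> \<rho> \<Theta> = a \<cdot> amap T r"
  using rho2_extension[of "Id C \<Theta>" \<Theta>] by (simp add: a_r a_em_algebra)

lemma em_solution_unique:
  assumes X [simp]: "X \<in> Obj C" and c: "c \<in> Hom C X (omap T (omap A X))"
    and "g \<in> Hom C X \<Theta>" "g = (a \<cdot> amap T r) \<cdot> amap T (amap A g) \<cdot> c"
    and "h \<in> Hom C X \<Theta>" "h = (a \<cdot> amap T r) \<cdot> amap T (amap A h) \<cdot> c"
  shows "g = h"
proof -
  note [simp] = free_em_algebra a_em_algebra
  define d where "d = rho2 C T \<eta> \<mu> A B \<kappa> \<rho> X \<cdot> c"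
  have [simp]: "c \<in> Arr C" "Dom C c = X" "Cod C c = omap T (omap A X)"
    using c by simp_all
  have rho2 [simp]: "rho2 C T \<eta> \<mu> A B \<kappa> \<rho> X \<in> Arr C"
    "Dom C (rho2 C T \<eta> \<mu> A B \<kappa> \<rho> X) = omap T (omap A X)"
    "Cod C (rho2 C T \<eta> \<mu> A B \<kappa> \<rho> X) = omap B (omap T X)"
    by (simp_all add: rho2_def em_free_def)
  have [simp]: "d \<in> Arr C" "Dom C d = X" "Cod C d = omap B (omap T X)"
    by (simp_all add: d_def)
  \<comment> \<open>The arrow \<open>d\<close> goes from \<open>X\<close> to \<open>B(T(X))\<close>;
    the last three factors form its determinization, a \<open>B\<close>-coalgebra on
    \<open>T(X)\<close> that does not depend on the solution \<open>f\<close>.\<close>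
  have ext: "\<zeta> \<cdot> a \<cdot> amap T f
      = amap B (a \<cdot> amap T f) \<cdot> amap B (\<mu> X) \<cdot> \<kappa> (omap T X) \<cdot> amap T d"
    if f: "f \<in> Hom C X \<Theta>" and sol: "f = (a \<cdot> amap T r) \<cdot> amap T (amap A f) \<cdot> c" for f
  proof -
    have [simp]: "f \<in> Arr C" "Dom C f = X" "Cod C f = \<Theta>" using f by simp_all
    define e where "e = a \<cdot> amap T f"
    have [simp]: "e \<in> Arr C" "Dom C e = omap T X" "Cod C e = \<Theta>" by (simp_all add: e_def)
    have e: "e \<cdot> \<mu> X = a \<cdot> amap T e"
      using extension_em_morphism(1)[OF f] by (simp only: e_def)
    have "\<zeta> \<cdot> f = \<zeta> \<cdot> (a \<cdot> amap T r) \<cdot> amap T (amap A f) \<cdot> c"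
      using sol by (rule arg_cong)
    \<comment> \<open>By \<open>a_r\<close> the algebra begins with the inverse of \<zeta>, which
      cancels; what remains is the right side of \<open>rho2_extension\<close>.\<close>
    also have "\<dots> = (amap B a \<cdot> \<kappa> \<Theta> \<cdot> amap T (\<rho> (\<Theta>, a)) \<cdot> amap T (amap A f)) \<cdot> c"
      unfolding a_r by (simp add: T.source.Comp_extend[OF \<zeta>_inverse(2)])
    also have "\<dots> = amap B e \<cdot> d"
      unfolding rho2_extension[OF f, symmetric] e_def[symmetric] d_def by simp
    finally have \<zeta>f: "\<zeta> \<cdot> f = amap B e \<cdot> d" .
    have "\<zeta> \<cdot> e = (\<zeta> \<cdot> a) \<cdot> amap T f" by (simp add: e_def)
    also have "\<dots> = amap B a \<cdot> \<kappa> \<Theta> \<cdot> amap T (\<zeta> \<cdot> f)"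
      unfolding \<zeta>_a by simp
    \<comment> \<open>Naturality of \<kappa> brings \<open>B(e)\<close> out of \<open>T\<close>. The
      next step replaces \<open>a \<cdot> T(e)\<close> by \<open>e \<cdot> \<mu> X\<close>, as
      \<open>e\<close> is an algebra morphism.\<close>
    also have "\<dots> = amap B (a \<cdot> amap T e) \<cdot> \<kappa> (omap T X) \<cdot> amap T d"
      unfolding \<zeta>f by (simp add: T.source.Comp_extend[OF \<kappa>_nat])
    also have "\<dots> = amap B e \<cdot> amap B (\<mu> X) \<cdot> \<kappa> (omap T X) \<cdot> amap T d"
      unfolding e[symmetric] by simp
    finally show ?thesis by (simp only: e_def)
  qed
  have [simp]: "g \<in> Arr C" "Dom C g = X" "Cod C g = \<Theta>" "h \<in> Arr C" "Dom C h = X" "Cod C h = \<Theta>"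
    using assms(3,5) by simp_all
  have "a \<cdot> amap T g = a \<cdot> amap T h"
    by (rule final_coalgebra_unique[OF final _ _ _ ext[OF assms(3,4)] _ ext[OF assms(5,6)]]) simp_all
  \<comment> \<open>Precomposition with the unit recovers each solution from its extension.\<close>
  then show ?thesis
    using extension_em_morphism(2)[OF assms(3)] extension_em_morphism(2)[OF assms(5)] by metis
qed

end

theorem theorem7p13:
  fixes C :: "('o, 'm) category" (structure)
    and T A B :: "('o, 'm, 'o, 'm) functor_map"
    and \<eta> \<mu> lam \<kappa> :: "'o \<Rightarrow> 'm"
    and \<rho> :: "'o \<times> 'm \<Rightarrow> 'm"
    and \<Psi> \<Theta> :: 'o
    and \<beta> \<zeta> a k kbar ell_kl ell_em :: 'm
  assumes "category C"
    and "monad C T \<eta> \<mu>"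
    and "endofunctor C A"
    and "initial_algebra C A \<Psi> \<beta>"
    and "kleisli_law C T \<eta> \<mu> A lam"
    and "final_coalgebra (Kl C T \<eta> \<mu>) (kl_extension C A lam) \<Psi> (amap (kl_J C \<eta>) (inverse_arr C \<beta>))"
    and "endofunctor C B"
    and "final_coalgebra C B \<Theta> \<zeta>"
    and "em_law C T \<eta> \<mu> B \<kappa>"
    and "nat_trans (EM C T \<eta> \<mu>) C (A \<circ>\<^sub>F em_forget) (em_forget \<circ>\<^sub>F em_lifting C B \<kappa>) \<rho>"
    and "\<And>Y b. (Y, b) \<in> Obj (EM C T \<eta> \<mu>) \<Longrightarrow>
      \<rho> (Y, b) \<cdot> amap A b = amap B b \<cdot> \<kappa> Y \<cdot> amap T (\<rho> (Y, b)) \<cdot> lam Y"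
    and "a = (THE f. f \<in> Hom C (omap T \<Theta>) \<Theta> \<and> \<zeta> \<cdot> f = amap B f \<cdot> \<kappa> \<Theta> \<cdot> amap T \<zeta>)"
    and "k = (THE f. f \<in> Hom C \<Psi> \<Theta> \<and> f \<cdot> \<beta> = inverse_arr C \<zeta> \<cdot> \<rho> (\<Theta>, a) \<cdot> amap A f)"
    and "kbar = a \<cdot> amap T k"
    and "ell_kl = amap T \<beta> \<cdot> \<mu> (omap A \<Psi>) \<cdot> amap T (lam \<Psi>)"
    and "ell_em = inverse_arr C \<zeta> \<cdot> amap B a \<cdot> rho2 C T \<eta> \<mu> A B \<kappa> \<rho> \<Theta>"
  shows "kbar \<cdot> ell_kl = ell_em \<cdot> amap (T \<circ>\<^sub>F A) kbar \<and>
    (\<forall>X\<in>Obj C. \<forall>c\<in>Hom C X (omap (T \<circ>\<^sub>F A) X).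
       kbar \<cdot> coalg_to_alg C (T \<circ>\<^sub>F A) X c (omap T \<Psi>) ell_kl
         = coalg_to_alg C (T \<circ>\<^sub>F A) X c \<Theta> ell_em)"
proof -
  interpret kl: kleisli_law C T \<eta> \<mu> A lam by fact
  interpret em: em_law C T \<eta> \<mu> B \<kappa> by fact
  interpret rho: nat_trans "EM C T \<eta> \<mu>" C "A \<circ>\<^sub>F em_forget" "em_forget \<circ>\<^sub>F em_lifting C B \<kappa>" \<rho>
    by fact
  interpret em_extension C T \<eta> \<mu> B \<kappa> \<Theta> \<zeta> a A \<rho>
    by unfold_locales fact+
  have \<Psi> [simp]: "\<Psi> \<in> Obj C" "\<beta> \<in> Arr C" "Dom C \<beta> = omap A \<Psi>" "Cod C \<beta> = \<Psi>"
    using assms(4) by (simp_all add: initial_algebra_def)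
  \<comment> \<open>Initiality applied to the algebra \<open>r\<close> on \<Theta>; after
    reassociation this shows that the description of \<open>k\<close> denotes.\<close>
  have "\<exists>!f. f \<in> Hom C \<Psi> \<Theta> \<and> f \<cdot> \<beta> = r \<cdot> amap A f"
    by (rule initial_algebra_ex1[OF assms(4)]) simp_all
  moreover have "f \<cdot> \<beta> = inverse_arr C \<zeta> \<cdot> \<rho> (\<Theta>, a) \<cdot> amap A f \<longleftrightarrow> f \<cdot> \<beta> = r \<cdot> amap A f"
    if "f \<in> Hom C \<Psi> \<Theta>" for f
    using that by (simp add: r_def a_em_algebra)
  ultimately have "\<exists>!f. f \<in> Hom C \<Psi> \<Theta> \<and> f \<cdot> \<beta> = inverse_arr C \<zeta> \<cdot> \<rho> (\<Theta>, a) \<cdot> amap A f"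
    by (simp cong: conj_cong)
  then have k_spec: "k \<in> Hom C \<Psi> \<Theta> \<and> k \<cdot> \<beta> = inverse_arr C \<zeta> \<cdot> \<rho> (\<Theta>, a) \<cdot> amap A k"
    unfolding assms(13) by (rule theI')
  then have k [simp]: "k \<in> Arr C" "Dom C k = \<Psi>" "Cod C k = \<Theta>" by simp_all
  have k\<beta>: "k \<cdot> \<beta> = r \<cdot> amap A k"
    using k_spec by (simp add: r_def a_em_algebra)
  have lam_nat: "lam \<Theta> \<cdot> amap A (amap T k) = amap T (amap A k) \<cdot> lam \<Psi>"
    using kl.law.naturality_Arr[of k] by simp
  have alg_obj: "(\<Theta>, a) \<in> Obj (EM C T \<eta> \<mu>)"
    by (simp add: EM_def a_em_algebra)
  \<comment> \<open>This is the compatibility of \<rho> with the two laws at the algebra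
    \<open>(\<Theta>, a)\<close>, preceded by the inverse of \<zeta> and folded up by
    \<open>a_r\<close>.\<close>
  have r_a: "r \<cdot> amap A a = a \<cdot> amap T r \<cdot> lam \<Theta>"
  proof -
    have "r \<cdot> amap A a = \<zeta>' \<cdot> \<rho> (\<Theta>, a) \<cdot> amap A a"
      by (simp add: r_def a_em_algebra)
    also have "\<dots> = (\<zeta>' \<cdot> amap B a \<cdot> \<kappa> \<Theta> \<cdot> amap T (\<rho> (\<Theta>, a))) \<cdot> lam \<Theta>"
      unfolding assms(11)[OF alg_obj] by (simp add: a_em_algebra)
    also have "\<dots> = a \<cdot> amap T r \<cdot> lam \<Theta>"
      unfolding a_r[symmetric] by simp
    finally show ?thesis .
  qed
  have ell_em: "ell_em = a \<cdot> amap T r"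
    unfolding assms(16) by (rule ell_em_eq)
  have alg: "kbar \<cdot> ell_kl = ell_em \<cdot> amap T (amap A kbar)"
  proof -
    have "kbar \<cdot> ell_kl = a \<cdot> amap T (k \<cdot> \<beta>) \<cdot> \<mu> (omap A \<Psi>) \<cdot> amap T (lam \<Psi>)"
      by (simp add: assms(14,15))
    also have "\<dots> = a \<cdot> (amap T (r \<cdot> amap A k) \<cdot> \<mu> (omap A \<Psi>)) \<cdot> amap T (lam \<Psi>)"
      unfolding k\<beta> by simp
    \<comment> \<open>Moving \<mu> next to \<open>a\<close> allows \<open>a_mult\<close> to trade it
      for \<open>T(a)\<close>; everything after the outer \<open>a\<close> then lies under a single
      \<open>T\<close>.\<close>
    also have "amap T (r \<cdot> amap A k) \<cdot> \<mu> (omap A \<Psi>) = \<mu> \<Theta> \<cdot> amap T (amap T (r \<cdot> amap A k))"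
      by (rule \<mu>_nat[symmetric]) simp_all
    also have "a \<cdot> (\<mu> \<Theta> \<cdot> amap T (amap T (r \<cdot> amap A k))) \<cdot> amap T (lam \<Psi>)
        = a \<cdot> amap T (a \<cdot> amap T r \<cdot> amap T (amap A k) \<cdot> lam \<Psi>)"
      by (simp add: kl.T.source.Comp_extend[OF a_mult])
    \<comment> \<open>Naturality of \<open>lam\<close> at \<open>k\<close> exposes the right side of
      \<open>r_a\<close>, so that the argument of \<open>T\<close> becomes \<open>r\<close> after
      \<open>A(kbar)\<close>.\<close>
    also have "\<dots> = a \<cdot> amap T ((a \<cdot> amap T r \<cdot> lam \<Theta>) \<cdot> amap A (amap T k))"
      unfolding lam_nat[symmetric] by simp
    also have "\<dots> = ell_em \<cdot> amap T (amap A kbar)"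
      unfolding r_a[symmetric] by (simp add: ell_em assms(14))
    finally show ?thesis .
  qed
  have kbar [simp]: "kbar \<in> Arr C" "Dom C kbar = omap T \<Psi>" "Cod C kbar = \<Theta>"
    by (simp_all add: assms(14))
  have kl [simp]: "ell_kl \<in> Arr C" "Dom C ell_kl = omap T (omap A (omap T \<Psi>))" "Cod C ell_kl = omap T \<Psi>"
    by (simp_all add: assms(15))
  have em [simp]: "ell_em \<in> Arr C" "Dom C ell_em = omap T (omap A \<Theta>)" "Cod C ell_em = \<Theta>"
    by (simp_all add: ell_em)
  have "kbar \<cdot> coalg_to_alg C (T \<circ>\<^sub>F A) X c (omap T \<Psi>) ell_kl
      = coalg_to_alg C (T \<circ>\<^sub>F A) X c \<Theta> ell_em"
    if X [simp]: "X \<in> Obj C" and c: "c \<in> Hom C X (omap (T \<circ>\<^sub>F A) X)" for X c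
  proof -
    have c': "c \<in> Hom C X (omap T (omap A X))" using c by simp
    then have [simp]: "c \<in> Arr C" "Dom C c = X" "Cod C c = omap T (omap A X)" by simp_all
    define u where "u = coalg_to_alg C (T \<circ>\<^sub>F A) X c (omap T \<Psi>) ell_kl"
    have u: "u \<in> Hom C X (omap T \<Psi>) \<and> u = ell_kl \<cdot> amap T (amap A u) \<cdot> c"
      unfolding u_def coalg_to_alg_def comp_functor_simps assms(15)
      by (rule theI'[OF kl.kl_solution_ex1[OF assms(4,6) X c']])
    then have [simp]: "u \<in> Arr C" "Dom C u = X" "Cod C u = omap T \<Psi>" unfolding Hom_iff by blast+
    have kbu: "kbar \<cdot> u \<in> Hom C X \<Theta>" by simp
    \<comment> \<open>Composing the equation for \<open>u\<close> with the algebra morphism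
      \<open>kbar\<close> yields a solution for \<open>ell_em\<close>; uniqueness of such solutions
      then identifies it.\<close>
    have "kbar \<cdot> u = kbar \<cdot> ell_kl \<cdot> amap T (amap A u) \<cdot> c"
      using conjunct2[OF u] by (rule arg_cong)
    also have "\<dots> = ell_em \<cdot> amap T (amap A (kbar \<cdot> u)) \<cdot> c"
      by (simp add: kl.T.source.Comp_extend[OF alg])
    finally have sol: "kbar \<cdot> u = ell_em \<cdot> amap (T \<circ>\<^sub>F A) (kbar \<cdot> u) \<cdot> c"
      unfolding comp_functor_simps .
    have "coalg_to_alg C (T \<circ>\<^sub>F A) X c \<Theta> ell_em = kbar \<cdot> u"
    proof (rule coalg_to_alg_eqI[OF kbu sol])
      fix g assume "g \<in> Hom C X \<Theta>" "g = ell_em \<cdot> amap (T \<circ>\<^sub>F A) g \<cdot> c"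
      then show "g = kbar \<cdot> u"
        using kbu sol unfolding ell_em comp_functor_simps by (rule em_solution_unique[OF X c'])
    qed
    then show ?thesis by (simp add: u_def)
  qed
  with alg show ?thesis unfolding comp_functor_simps by blast
qed

end
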